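(* Let $L$ and $L'$ be latin squares. (1) The Cayley table of a finite Abelian group with a unique involution has no odd-weights. (2) If $L$ has no odd-weights and $L'$ has the odd-block pattern of $L$, then $L'$ has no odd-weights.
   Context: A latin square of order $n$ is an $n\times n$ array each of whose cells contains a symbol from a fixed $n$-set such that no symbol appears twice in any row or column. It is identified with the set of triples $(x,y,z)$ such that the cell in row $x$ and column $y$ contains symbol $z$; for a latin square $L$, the symbol in row $x$ and column $y$ is also written $L(x,y)$. The Cayley table of a finite Abelian group $(G,+)$ is the latin square $\{(x,y,x+y): x,y\in G\}$, with rows, columns and symbols indexed by $G$. An involution is an element of order $2$. For $k\in\mathbb{Z}$, a $k$-weight of a latin square $L$ is a function $\theta:L\to\mathbb{Z}$ on the cells of $L$ whose sum over each row, over each column, and over all cells containing any given symbol is $k$. An odd-weight is a $k$-weight for some odd integer $k$. Block patterns: let $L$ be a latin square of order $m$. A latin square $L'$ has the $q$-block pattern of $L$ if $L'$ can be represented (with a suitable ordering of its rows and columns) by a block matrix $[A_{i,j}]_{1\le i,j\le m}$ where each $A_{i,j}$ is itself a latin square of order $q$, and blocks $A_{i,j}$ and $A_{i',j'}$ contain the same symbols if and only if $L(i,j)=L(i',j')$. $L'$ has the odd-block pattern of $L$ if it has the $q$-block pattern of $L$ for some odd $q$. *)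

theory Defs
  imports "HOL-Algebra.Algebra"
begin

record ('r, 'c, 's) square =
  rows :: "'r set"
  columns :: "'c set"
  symbols :: "'s set"
  entry :: "'r \<Rightarrow> 'c \<Rightarrow> 's"

text \<open>Only the values of \<open>entry L\<close> on \<open>rows L \<times> columns L\<close> are relevant.\<close>

definition latin_square_of_order :: "nat \<Rightarrow> ('r, 'c, 's) square \<Rightarrow> bool" where
  "latin_square_of_order n L \<longleftrightarrow>
     finite (rows L) \<and> card (rows L) = n \<and>
     finite (columns L) \<and> card (columns L) = n \<and>
     finite (symbols L) \<and> card (symbols L) = n \<and>
     (\<forall>x\<in>rows L. \<forall>y\<in>columns L. entry L x y \<in> symbols L) \<and>
     (\<forall>x\<in>rows L. inj_on (\<lambda>y. entry L x y) (columns L)) \<and>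
     (\<forall>y\<in>columns L. inj_on (\<lambda>x. entry L x y) (rows L))"

definition latin_square :: "('r, 'c, 's) square \<Rightarrow> bool" where
  "latin_square L \<longleftrightarrow> (\<exists>n. latin_square_of_order n L)"

definition triples :: "('r, 'c, 's) square \<Rightarrow> ('r \<times> 'c \<times> 's) set" where
  "triples L = {(x, y, entry L x y) | x y. x \<in> rows L \<and> y \<in> columns L}"

definition is_weight :: "int \<Rightarrow> ('r, 'c, 's) square \<Rightarrow> ('r \<times> 'c \<times> 's \<Rightarrow> int) \<Rightarrow> bool" where
  "is_weight k L \<theta> \<longleftrightarrow>
     (\<forall>r\<in>rows L. (\<Sum>t\<in>{(x, y, z) \<in> triples L. x = r}. \<theta> t) = k) \<and>
     (\<forall>c\<in>columns L. (\<Sum>t\<in>{(x, y, z) \<in> triples L. y = c}. \<theta> t) = k) \<and>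
     (\<forall>s\<in>symbols L. (\<Sum>t\<in>{(x, y, z) \<in> triples L. z = s}. \<theta> t) = k)"

definition has_odd_weight :: "('r, 'c, 's) square \<Rightarrow> bool" where
  "has_odd_weight L \<longleftrightarrow> (\<exists>k \<theta>. odd k \<and> is_weight k L \<theta>)"

definition cayley_table :: "('g, 'm) monoid_scheme \<Rightarrow> ('g, 'g, 'g) square" where
  "cayley_table G =
     \<lparr>rows = carrier G, columns = carrier G, symbols = carrier G, entry = (\<lambda>x y. x \<otimes>\<^bsub>G\<^esub> y)\<rparr>"

definition involution :: "('g, 'm) monoid_scheme \<Rightarrow> 'g \<Rightarrow> bool" where
  "involution G x \<longleftrightarrow> x \<in> carrier G \<and> group.ord G x = 2"

text \<open>
  An ordering of the rows of \<open>L'\<close> into consecutive groups of size \<open>q\<close>, one for each row of \<open>L\<close>,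
  is a bijection \<open>\<rho>\<close> from \<open>rows L \<times> {..<q}\<close>: row \<open>\<rho> (i, a)\<close> of \<open>L'\<close> is the \<open>a\<close>-th row of the
  \<open>i\<close>-th block row. Likewise \<open>\<gamma>\<close> for the columns. The symbols of a block are those that occur in it.
\<close>

definition block ::
  "nat \<Rightarrow> ('r2, 'c2, 's2) square \<Rightarrow> ('r \<times> nat \<Rightarrow> 'r2) \<Rightarrow> ('c \<times> nat \<Rightarrow> 'c2) \<Rightarrow> 'r \<Rightarrow> 'c
    \<Rightarrow> (nat, nat, 's2) square" where
  "block q L' \<rho> \<gamma> i j =
     \<lparr>rows = {..<q}, columns = {..<q},
      symbols = {entry L' (\<rho> (i, a)) (\<gamma> (j, b)) | a b. a < q \<and> b < q},
      entry = (\<lambda>a b. entry L' (\<rho> (i, a)) (\<gamma> (j, b)))\<rparr>"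

definition has_block_pattern ::
  "nat \<Rightarrow> ('r, 'c, 's) square \<Rightarrow> ('r2, 'c2, 's2) square \<Rightarrow> bool" where
  "has_block_pattern q L L' \<longleftrightarrow>
     (\<exists>\<rho> \<gamma>. bij_betw \<rho> (rows L \<times> {..<q}) (rows L') \<and>
            bij_betw \<gamma> (columns L \<times> {..<q}) (columns L') \<and>
            (\<forall>i\<in>rows L. \<forall>j\<in>columns L. latin_square_of_order q (block q L' \<rho> \<gamma> i j)) \<and>
            (\<forall>i\<in>rows L. \<forall>j\<in>columns L. \<forall>i'\<in>rows L. \<forall>j'\<in>columns L.
               symbols (block q L' \<rho> \<gamma> i j) = symbols (block q L' \<rho> \<gamma> i' j') \<longleftrightarrow>
               entry L i j = entry L i' j'))"

definition has_odd_block_pattern ::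
  "('r, 'c, 's) square \<Rightarrow> ('r2, 'c2, 's2) square \<Rightarrow> bool" where
  "has_odd_block_pattern L L' \<longleftrightarrow> (\<exists>q. odd q \<and> has_block_pattern q L L')"

lemma latin_square_cayley_table:
  assumes "group G" and "finite (carrier G)"
  shows "latin_square_of_order (order G) (cayley_table G)"
proof -
  interpret group G by fact
  show ?thesis
    using assms(2)
    by (auto simp: latin_square_of_order_def cayley_table_def order_def inj_on_def)
qed

end

theory Submission
  imports Defs
begin

text \<open>
  Both parts reduce to summing a \<open>k\<close>-weight over a well-chosen set of cells.

  (1) Let \<open>p\<close> be the product of all elements of the Abelian group \<open>G\<close>. Elements that differ from
  their inverse cancel in pairs, so \<open>p\<close> is the unique involution (\<open>finprod_carrier_eq_involution\<close>).
  For a \<open>k\<close>-weight \<open>\<theta>\<close> of the Cayley table, consider the product of \<open>(x \<otimes> y) [^] \<theta>\<close> over all cells.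
  Collecting equal symbols gives \<open>p [^] k\<close>. Splitting each factor and collecting equal rows and
  equal columns gives \<open>p [^] k \<otimes> p [^] k\<close>. Hence \<open>p [^] k = \<one>\<close>, and since \<open>p\<close> has order \<open>2\<close>, the
  number \<open>k\<close> is even. The collecting step is \<open>finprod_int_pow_by_value\<close>.

  (2) Summing a \<open>k\<close>-weight of \<open>L'\<close> over the blocks gives a function on the cells of \<open>L\<close>. It is a
  \<open>q * k\<close>-weight: a row of \<open>L\<close> stands for \<open>q\<close> rows of \<open>L'\<close>, and likewise for columns. A symbol \<open>s\<close> of
  \<open>L\<close> stands for the \<open>q\<close> symbols that occur in the blocks labelled \<open>s\<close>; these symbols occur in no
  other block (\<open>block_symbols_disjoint\<close>), so the blocks labelled \<open>s\<close> consist of all the cells of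
  \<open>L'\<close> that contain one of them. If \<open>q\<close> and \<open>k\<close> are odd, then so is \<open>q * k\<close>.
\<close>

section \<open>Weights as functions of the row and the column\<close>

lemma sum_triples:
  fixes \<theta> :: "'r \<times> 'c \<times> 's \<Rightarrow> int"
  assumes "finite (rows L)" "finite (columns L)"
  shows "(\<Sum>t\<in>{t \<in> triples L. P t}. \<theta> t) =
         (\<Sum>x\<in>rows L. \<Sum>y\<in>columns L. if P (x, y, entry L x y) then \<theta> (x, y, entry L x y) else 0)"
proof -
  let ?h = "\<lambda>c. (fst c, snd c, entry L (fst c) (snd c))"
  have im: "triples L = ?h ` (rows L \<times> columns L)"
    by (force simp: triples_def)
  have inj: "inj_on ?h (rows L \<times> columns L)"
    by (auto simp: inj_on_def)
  have fin: "finite (triples L)"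
    using assms by (simp add: im)
  have "(\<Sum>t\<in>{t \<in> triples L. P t}. \<theta> t) = (\<Sum>t\<in>triples L. if P t then \<theta> t else 0)"
    using fin by (simp add: sum.inter_filter)
  also have "\<dots> = (\<Sum>c\<in>rows L \<times> columns L. if P (?h c) then \<theta> (?h c) else 0)"
    unfolding im by (subst sum.reindex[OF inj]) (simp add: o_def)
  also have "\<dots> = (\<Sum>x\<in>rows L. \<Sum>y\<in>columns L.
      if P (x, y, entry L x y) then \<theta> (x, y, entry L x y) else 0)"
    by (simp add: sum.cartesian_product case_prod_unfold)
  finally show ?thesis .
qed

text \<open>
  The symbol component of a triple is determined by the other two, so a weight may be given by a
  function of these. All three sums then range over rows and columns, where they can be reordered
  and reindexed directly.
\<close>

definition cell_weight :: "int \<Rightarrow> ('r, 'c, 's) square \<Rightarrow> ('r \<Rightarrow> 'c \<Rightarrow> int) \<Rightarrow> bool" where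
  "cell_weight k L w \<longleftrightarrow>
     (\<forall>x\<in>rows L. (\<Sum>y\<in>columns L. w x y) = k) \<and>
     (\<forall>y\<in>columns L. (\<Sum>x\<in>rows L. w x y) = k) \<and>
     (\<forall>z\<in>symbols L. (\<Sum>x\<in>rows L. \<Sum>y\<in>columns L. if entry L x y = z then w x y else 0) = k)"

lemma is_weight_iff_cell_weight:
  assumes fin: "finite (rows L)" "finite (columns L)"
  shows "is_weight k L \<theta> \<longleftrightarrow> cell_weight k L (\<lambda>x y. \<theta> (x, y, entry L x y))"
proof -
  let ?w = "\<lambda>x y. \<theta> (x, y, entry L x y)"
  have row: "(\<Sum>t\<in>{(x, y, z) \<in> triples L. x = r}. \<theta> t) = (\<Sum>y\<in>columns L. ?w r y)"
    if "r \<in> rows L" for r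
  proof -
    have "(\<Sum>t\<in>{(x, y, z) \<in> triples L. x = r}. \<theta> t)
        = (\<Sum>x\<in>rows L. \<Sum>y\<in>columns L. if x = r then ?w x y else 0)"
      using sum_triples[OF fin, where P = "\<lambda>(x, y, z). x = r" and \<theta> = \<theta>]
      by (simp add: case_prod_unfold)
    also have "\<dots> = (\<Sum>x\<in>rows L. if x = r then \<Sum>y\<in>columns L. ?w x y else 0)"
      by (rule sum.cong) auto
    finally show ?thesis
      using that fin by simp
  qed
  have col: "(\<Sum>t\<in>{(x, y, z) \<in> triples L. y = c}. \<theta> t) = (\<Sum>x\<in>rows L. ?w x c)"
    if "c \<in> columns L" for c
    using sum_triples[OF fin, where P = "\<lambda>(x, y, z). y = c" and \<theta> = \<theta>] that fin
    by (simp add: case_prod_unfold)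
  have sym: "(\<Sum>t\<in>{(x, y, z) \<in> triples L. z = s}. \<theta> t)
      = (\<Sum>x\<in>rows L. \<Sum>y\<in>columns L. if entry L x y = s then ?w x y else 0)" for s
    using sum_triples[OF fin, where P = "\<lambda>(x, y, z). z = s" and \<theta> = \<theta>]
    by (simp add: case_prod_unfold)
  show ?thesis
    by (simp add: is_weight_def cell_weight_def row col sym)
qed

lemma has_odd_weight_iff:
  assumes "finite (rows L)" "finite (columns L)"
  shows "has_odd_weight L \<longleftrightarrow> (\<exists>k w. odd k \<and> cell_weight k L w)"
proof
  assume "has_odd_weight L"
  then show "\<exists>k w. odd k \<and> cell_weight k L w"
    using is_weight_iff_cell_weight[OF assms] unfolding has_odd_weight_def by blast
next
  assume "\<exists>k w. odd k \<and> cell_weight k L w"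
  then obtain k w where k: "odd k" and w: "cell_weight k L w"
    by blast
  have "is_weight k L (\<lambda>(x, y, z). w x y)"
    using w by (simp add: is_weight_iff_cell_weight[OF assms])
  with k show "has_odd_weight L"
    unfolding has_odd_weight_def by blast
qed


section \<open>Cayley tables\<close>

context comm_group
begin

text \<open>Each element cancels against its inverse.\<close>

lemma finprod_inv_closed_eq_one:
  assumes "finite S" "S \<subseteq> carrier G"
    and "\<And>x. x \<in> S \<Longrightarrow> inv x \<in> S" "\<And>x. x \<in> S \<Longrightarrow> inv x \<noteq> x"
  shows "(\<Otimes>x\<in>S. x) = \<one>"
  using assms
proof (induction "card S" arbitrary: S rule: less_induct)
  case less
  show ?case
  proof (cases "S = {}")
    case False
    then obtain x where x: "x \<in> S" by blast
    let ?T = "S - {x, inv x}"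
    have xG: "x \<in> carrier G" and iS: "inv x \<in> S" and ne: "inv x \<noteq> x"
      using less.prems x by auto
    have "card ?T < card S"
      using x less.prems(1) by (intro psubset_card_mono) auto
    moreover have "inv y \<in> ?T" if "y \<in> ?T" for y
      using that less.prems(2,3) xG by (auto simp: subset_iff)
    ultimately have T: "(\<Otimes>y\<in>?T. y) = \<one>"
      using less.prems by (intro less.hyps) auto
    have "S = insert x (insert (inv x) ?T)"
      using x iS by auto
    then have "(\<Otimes>y\<in>S. y) = (\<Otimes>y\<in>insert x (insert (inv x) ?T). y)"
      by simp
    also have "\<dots> = x \<otimes> (inv x \<otimes> (\<Otimes>y\<in>?T. y))"
      using less.prems(1,2) xG ne by (subst finprod_insert; (subst finprod_insert)?) auto
    also have "\<dots> = \<one>"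
      using xG by (simp add: T)
    finally show ?thesis .
  qed simp
qed

lemma involution_iff: "involution G x \<longleftrightarrow> x \<in> carrier G \<and> x \<noteq> \<one> \<and> inv x = x"
proof (cases "x \<in> carrier G")
  case True
  have "involution G x \<longleftrightarrow> ord x = 2"
    using True by (simp add: involution_def)
  also have "\<dots> \<longleftrightarrow> x [^] (2::nat) = \<one> \<and> x \<noteq> \<one>"
  proof -
    have "ord x = 2" if "ord x dvd 2" "ord x \<noteq> 1"
      using that by (metis prime_nat_iff two_is_prime_nat)
    then show ?thesis
      using True pow_eq_id[of x 2] ord_eq_1[of x] by force
  qed
  also have "x [^] (2::nat) = \<one> \<longleftrightarrow> inv x = x"
    using True by (metis inv_equality l_inv nat_pow_Suc nat_pow_0 l_one numeral_2_eq_2)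
  finally show ?thesis
    using True by blast
qed (simp add: involution_def)

lemma finprod_carrier_eq_involution:
  assumes fin: "finite (carrier G)" and t: "involution G t"
    and unique: "\<And>x. involution G x \<Longrightarrow> x = t"
  shows "(\<Otimes>x\<in>carrier G. x) = t"
proof -
  let ?T = "carrier G - {\<one>, t}"
  have tG: "t \<in> carrier G" and t1: "t \<noteq> \<one>" and it: "inv t = t"
    using t by (auto simp: involution_iff)
  have T: "(\<Otimes>x\<in>?T. x) = \<one>"
  proof (rule finprod_inv_closed_eq_one)
    show "inv x \<in> ?T" if "x \<in> ?T" for x
      using that it inv_inv by force
    show "inv x \<noteq> x" if "x \<in> ?T" for x
      using that unique by (auto simp: involution_iff)
  qed (use fin in auto)
  have "carrier G = insert \<one> (insert t ?T)"
    using tG by auto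
  then have "(\<Otimes>x\<in>carrier G. x) = (\<Otimes>x\<in>insert \<one> (insert t ?T). x)"
    by simp
  also have "\<dots> = \<one> \<otimes> (t \<otimes> (\<Otimes>x\<in>?T. x))"
    using fin tG t1 by (subst finprod_insert; (subst finprod_insert)?) auto
  finally show ?thesis
    using tG by (simp add: T)
qed

lemma finprod_int_pow:
  assumes "finite A" "f \<in> A \<rightarrow> carrier G"
  shows "(\<Otimes>a\<in>A. f a [^] (k::int)) = (\<Otimes>a\<in>A. f a) [^] k"
  using assms
proof (induction A rule: finite_induct)
  case (insert a A)
  then have "f a \<in> carrier G" "f \<in> A \<rightarrow> carrier G" by auto
  with insert show ?case
    by (simp add: int_pow_distrib Pi_iff)
qed simp

text \<open>
  In a product of powers, the exponents of equal bases may be added. The identity is applied to the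
  rows, to the columns and to the symbols of a Cayley table in turn, all of which are group elements.
\<close>

lemma finprod_int_pow_by_value:
  fixes \<theta> :: "'i \<Rightarrow> int"
  assumes fin: "finite (carrier G)" and A: "finite A" "f \<in> A \<rightarrow> carrier G"
    and k: "\<And>g. g \<in> carrier G \<Longrightarrow> (\<Sum>a\<in>A. if f a = g then \<theta> a else 0) = k"
  shows "(\<Otimes>a\<in>A. f a [^] \<theta> a) = (\<Otimes>g\<in>carrier G. g) [^] k"
proof -
  have "(\<Otimes>a\<in>A. f a [^] \<theta> a) =
      (\<Otimes>g\<in>carrier G. g [^] (\<Sum>a\<in>A. if f a = g then \<theta> a else 0))"
    using A
  proof (induction A rule: finite_induct)
    case (insert b A)
    then have fb: "f b \<in> carrier G" and fA: "f \<in> A \<rightarrow> carrier G" by auto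
    have single: "(\<Otimes>g\<in>carrier G. g [^] (if f b = g then \<theta> b else 0)) = f b [^] \<theta> b"
    proof -
      have "(\<Otimes>g\<in>carrier G. g [^] (if f b = g then \<theta> b else 0))
          = (\<Otimes>g\<in>carrier G. if f b = g then g [^] \<theta> b else \<one>)"
        by (rule finprod_cong') auto
      also have "\<dots> = f b [^] \<theta> b"
        using fb fin by (simp add: finprod_singleton)
      finally show ?thesis .
    qed
    have "(\<Otimes>a\<in>insert b A. f a [^] \<theta> a) = f b [^] \<theta> b \<otimes> (\<Otimes>a\<in>A. f a [^] \<theta> a)"
      using insert.hyps fb fA by (simp add: Pi_iff)
    also have "\<dots> = (\<Otimes>g\<in>carrier G. g [^] (if f b = g then \<theta> b else 0)) \<otimes>
        (\<Otimes>g\<in>carrier G. g [^] (\<Sum>a\<in>A. if f a = g then \<theta> a else 0))"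
      using insert.IH[OF fA] single by simp
    also have "\<dots> = (\<Otimes>g\<in>carrier G. g [^] (if f b = g then \<theta> b else 0) \<otimes>
        g [^] (\<Sum>a\<in>A. if f a = g then \<theta> a else 0))"
      by (rule finprod_multf[symmetric]) auto
    also have "\<dots> = (\<Otimes>g\<in>carrier G. g [^] (\<Sum>a\<in>insert b A. if f a = g then \<theta> a else 0))"
      using insert.hyps by (intro finprod_cong') (auto simp: int_pow_mult)
    finally show ?case .
  qed simp
  also have "\<dots> = (\<Otimes>g\<in>carrier G. g [^] k)"
    by (rule finprod_cong') (auto simp: k)
  also have "\<dots> = (\<Otimes>g\<in>carrier G. g) [^] k"
    using fin by (intro finprod_int_pow) auto
  finally show ?thesis .
qed

lemma cayley_table_no_odd_weight:
  assumes fin: "finite (carrier G)" and unique: "\<exists>!x. involution G x"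
  shows "\<not> has_odd_weight (cayley_table G)"
proof
  assume "has_odd_weight (cayley_table G)"
  then obtain k w where k: "odd k" and w: "cell_weight k (cayley_table G) w"
    using fin has_odd_weight_iff[of "cayley_table G"] by (auto simp: cayley_table_def)
  obtain t where t: "involution G t" and p: "(\<Otimes>g\<in>carrier G. g) = t"
    using unique finprod_carrier_eq_involution[OF fin] by blast
  have tG: "t \<in> carrier G" and t1: "t \<noteq> \<one>"
    using t by (auto simp: involution_iff)
  let ?A = "carrier G \<times> carrier G"
  let ?\<theta> = "\<lambda>c. w (fst c) (snd c)"
  have A: "finite ?A"
    using fin by simp
  have row: "(\<Otimes>c\<in>?A. fst c [^] ?\<theta> c) = t [^] k"
    unfolding p[symmetric]
  proof (rule finprod_int_pow_by_value[OF fin A])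
    fix g assume g: "g \<in> carrier G"
    have "(\<Sum>c\<in>?A. if fst c = g then ?\<theta> c else 0)
        = (\<Sum>x\<in>carrier G. \<Sum>y\<in>carrier G. if x = g then w x y else 0)"
      by (simp add: sum.cartesian_product case_prod_unfold)
    also have "\<dots> = (\<Sum>x\<in>carrier G. if x = g then \<Sum>y\<in>carrier G. w x y else 0)"
      by (rule sum.cong) auto
    also have "\<dots> = k"
      using w g fin by (simp add: cell_weight_def cayley_table_def)
    finally show "(\<Sum>c\<in>?A. if fst c = g then ?\<theta> c else 0) = k" .
  qed auto
  have col: "(\<Otimes>c\<in>?A. snd c [^] ?\<theta> c) = t [^] k"
    unfolding p[symmetric]
  proof (rule finprod_int_pow_by_value[OF fin A])
    fix g assume g: "g \<in> carrier G"
    have "(\<Sum>c\<in>?A. if snd c = g then ?\<theta> c else 0)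
        = (\<Sum>x\<in>carrier G. \<Sum>y\<in>carrier G. if y = g then w x y else 0)"
      by (simp add: sum.cartesian_product case_prod_unfold)
    also have "\<dots> = k"
      using w g fin by (simp add: cell_weight_def cayley_table_def)
    finally show "(\<Sum>c\<in>?A. if snd c = g then ?\<theta> c else 0) = k" .
  qed auto
  have sym: "(\<Otimes>c\<in>?A. (fst c \<otimes> snd c) [^] ?\<theta> c) = t [^] k"
    unfolding p[symmetric]
  proof (rule finprod_int_pow_by_value[OF fin A])
    fix g assume g: "g \<in> carrier G"
    have "(\<Sum>c\<in>?A. if fst c \<otimes> snd c = g then ?\<theta> c else 0)
        = (\<Sum>x\<in>carrier G. \<Sum>y\<in>carrier G. if x \<otimes> y = g then w x y else 0)"
      by (simp add: sum.cartesian_product case_prod_unfold)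
    also have "\<dots> = k"
      using w g by (simp add: cell_weight_def cayley_table_def)
    finally show "(\<Sum>c\<in>?A. if fst c \<otimes> snd c = g then ?\<theta> c else 0) = k" .
  qed auto
  have "t [^] k = (\<Otimes>c\<in>?A. fst c [^] ?\<theta> c \<otimes> snd c [^] ?\<theta> c)"
    unfolding sym[symmetric] by (rule finprod_cong') (auto simp: int_pow_distrib)
  also have "\<dots> = (\<Otimes>c\<in>?A. fst c [^] ?\<theta> c) \<otimes> (\<Otimes>c\<in>?A. snd c [^] ?\<theta> c)"
    by (rule finprod_multf) auto
  also have "\<dots> = t [^] k \<otimes> t [^] k"
    by (simp only: row col)
  finally have "t [^] k = \<one>"
    using tG by simp
  then have "int (ord t) dvd k"
    using tG by (simp add: int_pow_eq_id)
  with k t show False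
    by (simp add: involution_def)
qed

end


section \<open>Block patterns\<close>

lemma sum_bij_betw_Times:
  assumes "bij_betw \<rho> (A \<times> B) R"
  shows "(\<Sum>x\<in>R. f x) = (\<Sum>i\<in>A. \<Sum>a\<in>B. f (\<rho> (i, a)))"
  using sum.reindex_bij_betw[OF assms, of f]
  by (simp add: sum.cartesian_product case_prod_unfold)

lemma latin_square_row_image:
  assumes "latin_square_of_order n L" "x \<in> rows L"
  shows "(\<lambda>y. entry L x y) ` columns L = symbols L"
  using assms unfolding latin_square_of_order_def
  by (intro card_subset_eq) (auto simp: card_image)

text \<open>
  If \<open>j \<noteq> j'\<close>, then any row of \<open>L'\<close> through the block row \<open>i\<close> meets both blocks, and within each
  block it runs through all the symbols of that block; a common symbol would thus occur twice in it.
\<close>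

lemma block_symbols_disjoint:
  assumes L': "latin_square L'"
    and \<rho>: "bij_betw \<rho> (rows L \<times> {..<q}) (rows L')"
    and \<gamma>: "bij_betw \<gamma> (columns L \<times> {..<q}) (columns L')"
    and blocks: "\<And>i j. i \<in> rows L \<Longrightarrow> j \<in> columns L \<Longrightarrow>
      latin_square_of_order q (block q L' \<rho> \<gamma> i j)"
    and ij: "i \<in> rows L" "j \<in> columns L" "j' \<in> columns L" "j \<noteq> j'" and q: "q > 0"
  shows "symbols (block q L' \<rho> \<gamma> i j) \<inter> symbols (block q L' \<rho> \<gamma> i j') = {}"
proof (rule ccontr)
  assume "symbols (block q L' \<rho> \<gamma> i j) \<inter> symbols (block q L' \<rho> \<gamma> i j') \<noteq> {}"
  then obtain z where z: "z \<in> symbols (block q L' \<rho> \<gamma> i j)" "z \<in> symbols (block q L' \<rho> \<gamma> i j')"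
    by blast
  have occurs: "\<exists>b<q. z = entry L' (\<rho> (i, 0)) (\<gamma> (l, b))"
    if "l \<in> columns L" "z \<in> symbols (block q L' \<rho> \<gamma> i l)" for l
    using latin_square_row_image[OF blocks[OF ij(1) that(1)], of 0] that(2) q
    by (auto simp: block_def image_iff)
  obtain b b' where b: "b < q" "z = entry L' (\<rho> (i, 0)) (\<gamma> (j, b))"
    and b': "b' < q" "z = entry L' (\<rho> (i, 0)) (\<gamma> (j', b'))"
    using occurs z ij by blast
  have "\<rho> (i, 0) \<in> rows L'"
    using bij_betwE[OF \<rho>] ij q by auto
  moreover have "\<gamma> (j, b) \<in> columns L'" "\<gamma> (j', b') \<in> columns L'"
    using bij_betwE[OF \<gamma>] ij b b' by auto
  ultimately have "\<gamma> (j, b) = \<gamma> (j', b')"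
    using L' b b' unfolding latin_square_def latin_square_of_order_def inj_on_def by metis
  then have "(j, b) = (j', b')"
    using \<gamma> ij b b' unfolding bij_betw_def inj_on_def by blast
  with ij show False by simp
qed

lemma block_pattern_weight:
  assumes L: "latin_square L" and L': "latin_square L'" and q: "q > 0"
    and pattern: "has_block_pattern q L L'" and w: "cell_weight k L' w"
  shows "\<exists>v. cell_weight (int q * k) L v"
proof -
  obtain \<rho> \<gamma> where \<rho>: "bij_betw \<rho> (rows L \<times> {..<q}) (rows L')"
    and \<gamma>: "bij_betw \<gamma> (columns L \<times> {..<q}) (columns L')"
    and blocks: "\<And>i j. i \<in> rows L \<Longrightarrow> j \<in> columns L \<Longrightarrow>
      latin_square_of_order q (block q L' \<rho> \<gamma> i j)"
    and same: "\<And>i j i' j'. i \<in> rows L \<Longrightarrow> j \<in> columns L \<Longrightarrow> i' \<in> rows L \<Longrightarrow> j' \<in> columns L \<Longrightarrow>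
      symbols (block q L' \<rho> \<gamma> i j) = symbols (block q L' \<rho> \<gamma> i' j') \<longleftrightarrow> entry L i j = entry L i' j'"
    using pattern unfolding has_block_pattern_def by metis
  obtain n where n: "latin_square_of_order n L"
    using L by (auto simp: latin_square_def)
  define v where "v = (\<lambda>i j. \<Sum>a<q. \<Sum>b<q. w (\<rho> (i, a)) (\<gamma> (j, b)))"
  have \<rho>_mem: "\<rho> (i, a) \<in> rows L'" if "i \<in> rows L" "a < q" for i a
    using bij_betwE[OF \<rho>] that by auto
  have \<gamma>_mem: "\<gamma> (j, b) \<in> columns L'" if "j \<in> columns L" "b < q" for j b
    using bij_betwE[OF \<gamma>] that by auto
  have row: "(\<Sum>j\<in>columns L. v i j) = int q * k" if i: "i \<in> rows L" for i
  proof -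
    have "(\<Sum>j\<in>columns L. v i j) = (\<Sum>a<q. \<Sum>y\<in>columns L'. w (\<rho> (i, a)) y)"
      unfolding v_def sum_bij_betw_Times[OF \<gamma>] by (rule sum.swap)
    also have "\<dots> = (\<Sum>a<q. k)"
      using w \<rho>_mem[OF i] by (intro sum.cong) (auto simp: cell_weight_def)
    finally show ?thesis by simp
  qed
  have col: "(\<Sum>i\<in>rows L. v i j) = int q * k" if j: "j \<in> columns L" for j
  proof -
    have "(\<Sum>i\<in>rows L. v i j) = (\<Sum>x\<in>rows L'. \<Sum>b<q. w x (\<gamma> (j, b)))"
      unfolding v_def sum_bij_betw_Times[OF \<rho>] by simp
    also have "\<dots> = (\<Sum>b<q. \<Sum>x\<in>rows L'. w x (\<gamma> (j, b)))"
      by (rule sum.swap)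
    also have "\<dots> = (\<Sum>b<q. k)"
      using w \<gamma>_mem[OF j] by (intro sum.cong) (auto simp: cell_weight_def)
    finally show ?thesis by simp
  qed
  have sym: "(\<Sum>i\<in>rows L. \<Sum>j\<in>columns L. if entry L i j = s then v i j else 0) = int q * k"
    if s: "s \<in> symbols L" for s
  proof -
    have ne: "rows L \<noteq> {}"
      using n s by (auto simp: latin_square_of_order_def)
    then obtain i0 where i0: "i0 \<in> rows L" by blast
    then obtain j0 where j0: "j0 \<in> columns L" and e0: "entry L i0 j0 = s"
      using latin_square_row_image[OF n i0] s by (metis imageE)
    define Z where "Z = symbols (block q L' \<rho> \<gamma> i0 j0)"
    have fZ: "finite Z" and cZ: "card Z = q"
      using blocks[OF i0 j0] by (auto simp: Z_def latin_square_of_order_def)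
    have Z_sub: "Z \<subseteq> symbols L'"
      using L' \<rho>_mem[OF i0] \<gamma>_mem[OF j0]
      by (auto simp: Z_def block_def latin_square_def latin_square_of_order_def)
    have mem_Z: "entry L' (\<rho> (i, a)) (\<gamma> (j, b)) \<in> Z \<longleftrightarrow> entry L i j = s"
      if ij: "i \<in> rows L" "j \<in> columns L" and ab: "a < q" "b < q" for i j a b
    proof -
      have mem: "entry L' (\<rho> (i, a)) (\<gamma> (j, b)) \<in> symbols (block q L' \<rho> \<gamma> i j)"
        using ab by (auto simp: block_def)
      \<comment> \<open>Some block in block row \<open>i0\<close> has the same symbols as block \<open>(i, j)\<close>, and blocks in
        a common block row can be compared by disjointness.\<close>
      have "entry L i j \<in> symbols L"
        using n ij by (auto simp: latin_square_of_order_def)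
      then obtain j1 where j1: "j1 \<in> columns L" and e1: "entry L i0 j1 = entry L i j"
        using latin_square_row_image[OF n i0] by (metis imageE)
      have eq: "symbols (block q L' \<rho> \<gamma> i j) = symbols (block q L' \<rho> \<gamma> i0 j1)"
        using same[OF ij i0 j1] e1 by simp
      show ?thesis
      proof (cases "j1 = j0")
        case True
        then show ?thesis
          using mem eq e0 e1 by (simp add: Z_def)
      next
        case False
        have "entry L i0 j1 \<noteq> entry L i0 j0"
          using n i0 j0 j1 False by (auto simp: latin_square_of_order_def inj_on_def)
        moreover have "entry L' (\<rho> (i, a)) (\<gamma> (j, b)) \<notin> Z"
          using block_symbols_disjoint[OF L' \<rho> \<gamma> blocks i0 j1 j0 False q] mem eq
          by (auto simp: Z_def)
        ultimately show ?thesis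
          using e0 e1 by simp
      qed
    qed
    let ?f = "\<lambda>x y. if entry L' x y \<in> Z then w x y else 0"
    have "(\<Sum>i\<in>rows L. \<Sum>j\<in>columns L. if entry L i j = s then v i j else 0)
        = (\<Sum>i\<in>rows L. \<Sum>j\<in>columns L. \<Sum>a<q. \<Sum>b<q. ?f (\<rho> (i, a)) (\<gamma> (j, b)))"
      by (intro sum.cong refl) (auto simp: v_def mem_Z)
    also have "\<dots> = (\<Sum>x\<in>rows L'. \<Sum>y\<in>columns L'. ?f x y)"
      unfolding sum_bij_betw_Times[OF \<rho>] sum_bij_betw_Times[OF \<gamma>]
      by (intro sum.cong refl) (rule sum.swap)
    also have "\<dots> = (\<Sum>x\<in>rows L'. \<Sum>y\<in>columns L'. \<Sum>z\<in>Z. if entry L' x y = z then w x y else 0)"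
      using fZ by (intro sum.cong refl) simp
    also have "\<dots> = (\<Sum>x\<in>rows L'. \<Sum>z\<in>Z. \<Sum>y\<in>columns L'. if entry L' x y = z then w x y else 0)"
      by (intro sum.cong refl) (rule sum.swap)
    also have "\<dots> = (\<Sum>z\<in>Z. \<Sum>x\<in>rows L'. \<Sum>y\<in>columns L'. if entry L' x y = z then w x y else 0)"
      by (rule sum.swap)
    also have "\<dots> = (\<Sum>z\<in>Z. k)"
      using w Z_sub by (intro sum.cong) (auto simp: cell_weight_def)
    finally show ?thesis
      by (simp add: cZ)
  qed
  show ?thesis
    using row col sym unfolding cell_weight_def by blast
qed

theorem theorem4:
  fixes G :: "('g, 'm) monoid_scheme"
    and L :: "('r, 'c, 's) square"
    and L' :: "('r2, 'c2, 's2) square"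
  shows "(comm_group G \<and> finite (carrier G) \<and> (\<exists>!x. involution G x)
            \<longrightarrow> \<not> has_odd_weight (cayley_table G)) \<and>
         (latin_square L \<and> latin_square L' \<and> \<not> has_odd_weight L \<and> has_odd_block_pattern L L'
            \<longrightarrow> \<not> has_odd_weight L')"
proof (intro conjI impI)
  assume "comm_group G \<and> finite (carrier G) \<and> (\<exists>!x. involution G x)"
  then show "\<not> has_odd_weight (cayley_table G)"
    using comm_group.cayley_table_no_odd_weight by blast
next
  assume *: "latin_square L \<and> latin_square L' \<and> \<not> has_odd_weight L \<and> has_odd_block_pattern L L'"
  then obtain q where q: "odd q" and pattern: "has_block_pattern q L L'"
    by (auto simp: has_odd_block_pattern_def)
  have fin: "finite (rows L)" "finite (columns L)" "finite (rows L')" "finite (columns L')"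
    using * by (auto simp: latin_square_def latin_square_of_order_def)
  show "\<not> has_odd_weight L'"
  proof
    assume "has_odd_weight L'"
    then obtain k w where k: "odd k" and w: "cell_weight k L' w"
      using fin has_odd_weight_iff by blast
    obtain v where "cell_weight (int q * k) L v"
      using block_pattern_weight[OF _ _ odd_pos[OF q] pattern w] * by blast
    moreover have "odd (int q * k)"
      using q k by simp
    ultimately have "has_odd_weight L"
      using fin has_odd_weight_iff by blast
    with * show False by simp
  qed
qed

end
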